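(* Let $\phi$ be an invariant fan valuation on $\mathbf{Fans}_d$ taking values in an abelian group $G$. Then there are $a_0,\dots,a_{d-1}\in G$ such that for every hyperplane arrangement $\mathcal{A}$ in a linear subspace of $\mathbb{R}^d$ \[ \phi(\mathcal{N}(\mathcal{A})) \ = \ a_0\, w_0(\mathcal{A}) + \cdots + a_{d-1}\, w_{d-1}(\mathcal{A}) \, . \] Moreover, the $a_i$ are determined by the values $\phi(\mathcal{N}(\mathcal{A}^k))$, where $\mathcal{A}^k$ is a $k$-singleton, $1\le k\le d$.
   Context: Polyhedral cones are nonempty and contain the origin. For a cone $C$, $\mathrm{lin}(C)$ is its linear hull and $\mathrm{relint}(C)$ its relative interior. A fan in $\mathbb{R}^d$ is a finite collection $\mathcal{N}$ of polyhedral cones in $\mathbb{R}^d$ such that for all $C,C'\in\mathcal{N}$: (i) $C\cap C'$ is a face of $C$, and (ii) $\mathrm{lin}(C)=\mathrm{lin}(C')$; this common linear hull is denoted $\mathrm{lin}(\mathcal{N})$. $\mathbf{Fans}_d$ is the set of all fans in $\mathbb{R}^d$, including the empty fan $\emptyset$. For a set $S\subseteq \mathrm{lin}(\mathcal{N})$ put $\mathcal{N}\cap S = \{C\cap S : C\in\mathcal{N},\ \mathrm{relint}(C)\cap S\neq\emptyset\}$. A map $\phi$ from $\mathbf{Fans}_d$ to an abelian group is a fan valuation if $\phi(\emptyset)=0$ and for every nonempty fan $\mathcal{N}\in\mathbf{Fans}_d$ and every linear hyperplane $H\subseteq\mathrm{lin}(\mathcal{N})$ (linear subspace of codimension 1 in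 $\mathrm{lin}(\mathcal{N})$) one has $\phi(\mathcal{N})=\phi(\mathcal{N}\cap H^{\le})+\phi(\mathcal{N}\cap H^{\ge})-\phi(\mathcal{N}\cap H)$, where $H^{\le},H^{\ge}$ are the two closed halfspaces of $\mathrm{lin}(\mathcal{N})$ bounded by $H$. It is invariant if $\phi(\{gC : C\in\mathcal{N}\})=\phi(\mathcal{N})$ for all $g\in\mathrm{SO}(\mathbb{R}^d)$ and $\mathcal{N}\in\mathbf{Fans}_d$; an invariant fan valuation takes the same value on the fans of all $k$-singletons. A hyperplane arrangement $\mathcal{A}$ is a nonempty finite collection of linear hyperplanes in some linear subspace $L\subseteq\mathbb{R}^d$; $\mathcal{N}(\mathcal{A})$ is the fan of closures of the connected components of $L\setminus\bigcup\mathcal{A}$. For $1\le k\le d$, a $k$-singleton is an arrangement consisting of a single hyperplane in a $k$-dimensional linear subspace of $\mathbb{R}^d$. For $H\in\mathcal{A}$, $\mathcal{A}\backslash H=\{H'\in\mathcal{A}:H'\ne H\}$ (in $L$) and $\mathcal{A}/H=\{H'\cap H : H'\in\mathcal{A},H'\neq H\}$ (in $H$). The unsigned characteristic polynomial is defined recursively by $\overline{\chi}_{\mathcal{A}}(t)=t^k+t^{k-1}$ if $\mathcal{A}$ is a $k$-singleton and $\overline{\chi}_{\mathcal{A}}(t)=\overline{\chi}_{\mathcal{A}\backslash H}(t)+\overline{\chi}_{\mathcal{A}/H}(t)$ for $H\in\mathcal{A}$ if $\mathcal{A}$ has more than one hyperplane; it equals $(-1)^{\dim L}\chi_{\mathcal{A}}(-t)$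 with $\chi_{\mathcal{A}}$ the usual characteristic polynomial. The (unsigned) Whitney number of the first kind $w_i(\mathcal{A})$ is the coefficient of $t^i$ in $\overline{\chi}_{\mathcal{A}}(t)$. *)

theory Defs
  imports "HOL-Analysis.Analysis" "HOL-Computational_Algebra.Polynomial"
begin

definition polyhedral_cone :: "'a::euclidean_space set \<Rightarrow> bool" where
  "polyhedral_cone C \<longleftrightarrow> polyhedron C \<and> cone C \<and> C \<noteq> {}"

definition fan :: "'a::euclidean_space set set \<Rightarrow> bool" where
  "fan N \<longleftrightarrow> finite N \<and> (\<forall>C\<in>N. polyhedral_cone C) \<and>
     (\<forall>C\<in>N. \<forall>C'\<in>N. (C \<inter> C') face_of C \<and> span C = span C')"

definition fan_lin :: "'a::euclidean_space set set \<Rightarrow> 'a set" where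
  "fan_lin N = span (\<Union>N)"

lemma fan_lin_eq:
  assumes "fan N" "C \<in> N"
  shows "fan_lin N = span C"
proof
  have "\<Union>N \<subseteq> span C"
    using assms unfolding fan_def by (metis Sup_least span_superset)
  then show "fan_lin N \<subseteq> span C"
    unfolding fan_lin_def by (simp add: span_minimal)
  show "span C \<subseteq> fan_lin N"
    unfolding fan_lin_def using assms(2) by (intro span_mono) auto
qed

definition fan_section :: "'a::euclidean_space set set \<Rightarrow> 'a set \<Rightarrow> 'a set set" where
  "fan_section N S = {C \<inter> S | C. C \<in> N \<and> rel_interior C \<inter> S \<noteq> {}}"

definition hyperplane_in :: "'a::euclidean_space set \<Rightarrow> 'a set \<Rightarrow> bool" where
  "hyperplane_in L H \<longleftrightarrow> subspace H \<and> H \<subseteq> L \<and> dim L = dim H + 1"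

text \<open>The two closed halfspaces of \<open>V = lin N\<close> bounded by \<open>H\<close> are given by a vector \<open>u\<close> with
  \<open>H = {x \<in> V. u \<bullet> x = 0}\<close>.  Such a \<open>u\<close> exists for every \<open>H\<close>, and its restriction to \<open>V\<close> is unique
  up to a nonzero factor, so the choice of \<open>u\<close> can only interchange the two halfspaces.\<close>

definition fan_valuation :: "('a::euclidean_space set set \<Rightarrow> 'g::ab_group_add) \<Rightarrow> bool" where
  "fan_valuation \<phi> \<longleftrightarrow> \<phi> {} = 0 \<and>
     (\<forall>N H u. fan N \<and> N \<noteq> {} \<and> hyperplane_in (fan_lin N) H \<and> H = {x \<in> fan_lin N. u \<bullet> x = 0} \<longrightarrow>
        \<phi> N = \<phi> (fan_section N {x \<in> fan_lin N. u \<bullet> x \<le> 0})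
            + \<phi> (fan_section N {x \<in> fan_lin N. u \<bullet> x \<ge> 0})
            - \<phi> (fan_section N H))"

definition rotation_invariant :: "((real^'n) set set \<Rightarrow> 'g) \<Rightarrow> bool" where
  "rotation_invariant \<phi> \<longleftrightarrow>
     (\<forall>g N. rotation_matrix g \<and> fan N \<longrightarrow> \<phi> ((\<lambda>C. (\<lambda>x. g *v x) ` C) ` N) = \<phi> N)"

definition invariant_fan_valuation :: "((real^'n) set set \<Rightarrow> 'g::ab_group_add) \<Rightarrow> bool" where
  "invariant_fan_valuation \<phi> \<longleftrightarrow> fan_valuation \<phi> \<and> rotation_invariant \<phi>"

text \<open>The ambient space \<open>L\<close> is carried along explicitly; it is not determined by the set of
  hyperplanes when there is only one of them.\<close>

definition arrangement :: "'a::euclidean_space set \<Rightarrow> 'a set set \<Rightarrow> bool" where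
  "arrangement L A \<longleftrightarrow> subspace L \<and> finite A \<and> A \<noteq> {} \<and> (\<forall>H\<in>A. hyperplane_in L H)"

definition arrangement_fan :: "'a::euclidean_space set \<Rightarrow> 'a set set \<Rightarrow> 'a set set" where
  "arrangement_fan L A = closure ` components (L - \<Union>A)"

definition singleton_arrangement :: "nat \<Rightarrow> 'a::euclidean_space set \<Rightarrow> 'a set set \<Rightarrow> bool" where
  "singleton_arrangement k L A \<longleftrightarrow> arrangement L A \<and> card A = 1 \<and> dim L = k"

definition restrict_arrangement :: "'a::euclidean_space set set \<Rightarrow> 'a set \<Rightarrow> 'a set set" where
  "restrict_arrangement A H = (\<lambda>H'. H' \<inter> H) ` (A - {H})"

text \<open>\<open>is_ucharpoly L A p\<close>: the polynomial \<open>p\<close> is obtained by some run of the deletion--restriction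
  recursion, with an arbitrary choice of \<open>H\<close> at each step.  The outcome does not depend on the choices
  (\<open>ex1_ucharpoly\<close> below), so the definite description in \<open>ucharpoly\<close> is proper.\<close>

inductive is_ucharpoly :: "'a::euclidean_space set \<Rightarrow> 'a set set \<Rightarrow> nat poly \<Rightarrow> bool" where
  singleton: "singleton_arrangement k L A \<Longrightarrow> is_ucharpoly L A (monom 1 k + monom 1 (k - 1))"
| deletion_restriction:
    "arrangement L A \<Longrightarrow> card A > 1 \<Longrightarrow> H \<in> A \<Longrightarrow>
     is_ucharpoly L (A - {H}) p \<Longrightarrow> is_ucharpoly H (restrict_arrangement A H) q \<Longrightarrow>
     is_ucharpoly L A (p + q)"

definition ucharpoly :: "'a::euclidean_space set \<Rightarrow> 'a set set \<Rightarrow> nat poly" where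
  "ucharpoly L A = (THE p. is_ucharpoly L A p)"

definition whitney_number :: "nat \<Rightarrow> 'a::euclidean_space set \<Rightarrow> 'a set set \<Rightarrow> nat" where
  "whitney_number i L A = coeff (ucharpoly L A) i"

definition nat_multiple :: "nat \<Rightarrow> 'g::ab_group_add \<Rightarrow> 'g" where
  "nat_multiple n a = (\<Sum>_<n. a)"

lemma arrangement_delete:
  assumes "arrangement L A" "card A > 1" "H \<in> A"
  shows "arrangement L (A - {H})"
proof -
  have "A - {H} \<noteq> {}"
    using assms by (metis card.empty card_Diff_singleton less_numeral_extra(3) zero_less_diff)
  then show ?thesis using assms(1) by (auto simp: arrangement_def)
qed

lemma hyperplane_in_Int:
  assumes L: "subspace L" and H: "hyperplane_in L H" and H': "hyperplane_in L H'" and ne: "H' \<noteq> H"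
  shows "hyperplane_in H (H' \<inter> H)"
proof -
  let ?S = "{x + y |x y. x \<in> H' \<and> y \<in> H}"
  have sub: "subspace H" "subspace H'" "H \<subseteq> L" "H' \<subseteq> L"
    and dims: "dim L = dim H + 1" "dim L = dim H' + 1"
    using H H' by (auto simp: hyperplane_in_def)
  have S: "subspace ?S" by (rule subspace_sums) (use sub in auto)
  have SL: "?S \<subseteq> L" using sub L by (auto intro: subspace_add)
  have H'S: "H' \<subseteq> ?S" using subspace_0[OF sub(1)] by force
  have HS: "H \<subseteq> ?S" using subspace_0[OF sub(2)] by force
  have "dim ?S \<noteq> dim H"
  proof
    assume "dim ?S = dim H"
    then have "H = ?S" using HS S sub(1) by (intro subspace_dim_equal) auto
    then have "H' \<subseteq> H" using H'S by simp
    then show False using ne dims subspace_dim_equal[of H' H] sub by auto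
  qed
  moreover have "dim H \<le> dim ?S" using HS by (rule dim_subset)
  moreover have "dim ?S \<le> dim L" using SL by (rule dim_subset)
  ultimately have "dim ?S = dim L" using dims by linarith
  moreover have "dim ?S + dim (H' \<inter> H) = dim H' + dim H"
    using sub by (intro dim_sums_Int) auto
  ultimately have "dim H = dim (H' \<inter> H) + 1" using dims by linarith
  then show ?thesis using sub by (auto simp: hyperplane_in_def subspace_inter)
qed

lemma arrangement_restrict:
  assumes "arrangement L A" "card A > 1" "H \<in> A"
  shows "arrangement H (restrict_arrangement A H)"
  using arrangement_delete[OF assms] assms hyperplane_in_Int[of L H]
  by (auto simp: arrangement_def restrict_arrangement_def hyperplane_in_def[of L])

lemma is_ucharpoly_exists: "arrangement L A \<Longrightarrow> \<exists>p. is_ucharpoly L A p"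
proof (induction "card A" arbitrary: L A rule: less_induct)
  case less
  then have fin: "finite A" "A \<noteq> {}" by (auto simp: arrangement_def)
  show ?case
  proof (cases "card A = 1")
    case True
    then show ?thesis using singleton less.prems by (fastforce simp: singleton_arrangement_def)
  next
    case False
    then have c: "card A > 1" using fin by (metis One_nat_def card_gt_0_iff less_Suc_eq_0_disj
          linorder_neqE_nat not_gr_zero)
    obtain H where H: "H \<in> A" using fin by blast
    have "card (A - {H}) < card A" using fin H by (meson card_Diff1_less)
    moreover have "card (restrict_arrangement A H) \<le> card (A - {H})"
      unfolding restrict_arrangement_def using fin by (intro card_image_le) auto
    ultimately obtain p q where "is_ucharpoly L (A - {H}) p" "is_ucharpoly H (restrict_arrangement A H) q"
      using less.hyps arrangement_delete[OF less.prems c H] arrangement_restrict[OF less.prems c H]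
      by (metis le_less_trans)
    then show ?thesis using deletion_restriction[OF less.prems c H] by blast
  qed
qed

lemma sum_Pow_insert:
  fixes f :: "'b set \<Rightarrow> 'c::ab_group_add"
  assumes "finite X" "x \<notin> X"
  shows "(\<Sum>B\<in>Pow (insert x X). f B) = (\<Sum>B\<in>Pow X. f B) + (\<Sum>B\<in>Pow X. f (insert x B))"
proof -
  have "inj_on (insert x) (Pow X)" using assms(2) by (auto simp: inj_on_def)
  moreover have "Pow X \<inter> insert x ` Pow X = {}" using assms(2) by auto
  ultimately show ?thesis
    using assms(1) by (simp add: Pow_insert sum.union_disjoint sum.reindex)
qed

lemma sum_Pow_insert_sign:
  fixes f :: "'b set \<Rightarrow> 'c::comm_ring_1"
  assumes "finite X" "x \<notin> X"
  shows "(\<Sum>B\<in>Pow (insert x X). (-1) ^ card B * f B)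
       = (\<Sum>B\<in>Pow X. (-1) ^ card B * (f B - f (insert x B)))"
proof -
  have "(\<Sum>B\<in>Pow X. (-1) ^ card (insert x B) * f (insert x B))
      = (\<Sum>B\<in>Pow X. - ((-1) ^ card B * f (insert x B)))"
  proof (rule sum.cong)
    fix B assume "B \<in> Pow X"
    then have "finite B" "x \<notin> B" using assms finite_subset by auto
    then show "(-1) ^ card (insert x B) * f (insert x B) = - ((-1) ^ card B * f (insert x B))" by simp
  qed simp
  then show ?thesis
    by (subst sum_Pow_insert[OF assms]) (simp add: sum_negf sum_subtractf algebra_simps)
qed

lemma sum_Pow_image_sign:
  fixes g :: "'b set \<Rightarrow> 'c::comm_ring_1"
  assumes "finite X"
  shows "(\<Sum>B\<in>Pow X. (-1) ^ card B * g (r ` B)) = (\<Sum>C\<in>Pow (r ` X). (-1) ^ card C * g C)"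
  using assms
proof (induction X arbitrary: g)
  case empty
  then show ?case by simp
next
  case (insert x X)
  have "(\<Sum>B\<in>Pow (insert x X). (-1) ^ card B * g (r ` B))
      = (\<Sum>B\<in>Pow X. (-1) ^ card B * (g (r ` B) - g (insert (r x) (r ` B))))"
    using sum_Pow_insert_sign[OF insert.hyps, of "\<lambda>B. g (r ` B)"] by simp
  also have "\<dots> = (\<Sum>C\<in>Pow (r ` X). (-1) ^ card C * (g C - g (insert (r x) C)))"
    by (rule insert.IH)
  also have "\<dots> = (\<Sum>C\<in>Pow (r ` insert x X). (-1) ^ card C * g C)"
  proof (cases "r x \<in> r ` X")
    case False
    then show ?thesis using sum_Pow_insert_sign[of "r ` X" "r x" g] insert.hyps(1) by simp
  next
    case True
    let ?Y = "r ` X - {r x}"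
    have Y: "r ` X = insert (r x) ?Y" "finite ?Y" "r x \<notin> ?Y" using True insert.hyps(1) by auto
    have "(\<Sum>C\<in>Pow (r ` X). (-1) ^ card C * g (insert (r x) C)) = 0"
      by (subst Y(1), subst sum_Pow_insert_sign[OF Y(2,3), of "\<lambda>C. g (insert (r x) C)"]) simp
    moreover have "r ` insert x X = r ` X" using True by auto
    ultimately show ?thesis by (simp add: right_diff_distrib sum_subtractf)
  qed
  finally show ?case .
qed

lemma of_nat_poly_add:
  "map_poly of_nat (p + q) = (map_poly of_nat p + map_poly of_nat q :: int poly)"
  by (rule poly_eqI) (simp add: coeff_map_poly)

text \<open>Whitney's subset expansion: the right-hand side is \<open>(-1)\<^bsup>dim L\<^esup> \<chi>(-t)\<close>.\<close>

lemma is_ucharpoly_whitney: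
  assumes "is_ucharpoly L A p"
  shows "map_poly of_nat p = (-1) ^ dim L *
    (\<Sum>B\<in>Pow A. (-1) ^ card B * monom ((-1) ^ dim (L \<inter> \<Inter>B)) (dim (L \<inter> \<Inter>B)) :: int poly)"
  using assms
proof induction
  case (singleton k L A)
  then obtain H where A: "A = {H}" and H: "hyperplane_in L H" and k: "dim L = k"
    by (auto simp: singleton_arrangement_def arrangement_def card_1_singleton_iff)
  then have LH: "L \<inter> H = H" "k = Suc (dim H)" by (auto simp: hyperplane_in_def)
  have sg: "(-1) ^ n * monom ((-1) ^ n) m = (monom 1 m :: int poly)" for n m
  proof -
    have "(-1) ^ n = [: (-1) ^ n :: int :]" by (induction n) auto
    then show ?thesis by (simp add: smult_monom flip: power_mult_distrib)
  qed
  have "Pow A = {{}, {H}}" using A by auto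
  then show ?case
    using sg[of "Suc (dim H)" "Suc (dim H)"] sg[of "dim H" "dim H"]
    by (simp add: LH k of_nat_poly_add map_poly_monom algebra_simps)
next
  case (deletion_restriction L A H p q)
  let ?q = "\<lambda>V :: 'a set. monom ((-1) ^ dim V) (dim V) :: int poly"
  have fin: "finite A" and H: "hyperplane_in L H" and A: "A = insert H (A - {H})"
    using deletion_restriction by (auto simp: arrangement_def)
  have HL: "H \<subseteq> L" and dL: "dim L = Suc (dim H)" using H by (auto simp: hyperplane_in_def)
  have "(\<Sum>C\<in>Pow (restrict_arrangement A H). (-1) ^ card C * ?q (H \<inter> \<Inter>C))
      = (\<Sum>B\<in>Pow (A - {H}). (-1) ^ card B * ?q (H \<inter> \<Inter>((\<lambda>H'. H' \<inter> H) ` B)))"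
    unfolding restrict_arrangement_def
    by (rule sum_Pow_image_sign[symmetric]) (use fin in auto)
  also have "\<dots> = (\<Sum>B\<in>Pow (A - {H}). (-1) ^ card B * ?q (L \<inter> \<Inter>(insert H B)))"
  proof (rule sum.cong)
    fix B
    have "H \<inter> \<Inter>((\<lambda>H'. H' \<inter> H) ` B) = L \<inter> \<Inter>(insert H B)" using HL by auto
    then show "(-1) ^ card B * ?q (H \<inter> \<Inter>((\<lambda>H'. H' \<inter> H) ` B)) = (-1) ^ card B * ?q (L \<inter> \<Inter>(insert H B))"
      by (simp only:)
  qed simp
  finally have R: "(\<Sum>C\<in>Pow (restrict_arrangement A H). (-1) ^ card C * ?q (H \<inter> \<Inter>C))
      = (\<Sum>B\<in>Pow (A - {H}). (-1) ^ card B * ?q (L \<inter> \<Inter>(insert H B)))" .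
  have "(\<Sum>B\<in>Pow A. (-1) ^ card B * ?q (L \<inter> \<Inter>B))
      = (\<Sum>B\<in>Pow (A - {H}). (-1) ^ card B * (?q (L \<inter> \<Inter>B) - ?q (L \<inter> \<Inter>(insert H B))))"
    by (subst A, rule sum_Pow_insert_sign) (use fin in auto)
  also have "\<dots> = (\<Sum>B\<in>Pow (A - {H}). (-1) ^ card B * ?q (L \<inter> \<Inter>B))
      - (\<Sum>C\<in>Pow (restrict_arrangement A H). (-1) ^ card C * ?q (H \<inter> \<Inter>C))"
    unfolding R right_diff_distrib sum_subtractf ..
  finally have S: "(\<Sum>B\<in>Pow A. (-1) ^ card B * ?q (L \<inter> \<Inter>B))
      = (\<Sum>B\<in>Pow (A - {H}). (-1) ^ card B * ?q (L \<inter> \<Inter>B))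
      - (\<Sum>C\<in>Pow (restrict_arrangement A H). (-1) ^ card C * ?q (H \<inter> \<Inter>C))" .
  show ?case
    unfolding S of_nat_poly_add deletion_restriction.IH by (simp add: dL algebra_simps)
qed

lemma ex1_ucharpoly:
  assumes "arrangement L A"
  shows "\<exists>!p. is_ucharpoly L A p"
proof -
  have "p = q" if "is_ucharpoly L A p" "is_ucharpoly L A q" for p q
  proof -
    have "map_poly of_nat p = (map_poly of_nat q :: int poly)"
      using that by (simp add: is_ucharpoly_whitney)
    then have "coeff p i = coeff q i" for i
      by (metis coeff_map_poly of_nat_0 of_nat_eq_iff)
    then show ?thesis by (rule poly_eqI)
  qed
  then show ?thesis using is_ucharpoly_exists[OF assms] by blast
qed

lemma ucharpoly_eqI: "arrangement L A \<Longrightarrow> is_ucharpoly L A p \<Longrightarrow> ucharpoly L A = p"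
  unfolding ucharpoly_def using ex1_ucharpoly by (blast intro: the1_equality)

lemma is_ucharpoly_ucharpoly: "arrangement L A \<Longrightarrow> is_ucharpoly L A (ucharpoly L A)"
  unfolding ucharpoly_def by (rule theI'[OF ex1_ucharpoly])

theorem ucharpoly_singleton:
  "singleton_arrangement k L A \<Longrightarrow> ucharpoly L A = monom 1 k + monom 1 (k - 1)"
  by (rule ucharpoly_eqI[OF _ singleton]) (auto simp: singleton_arrangement_def)

theorem ucharpoly_deletion_restriction:
  assumes "arrangement L A" "card A > 1" "H \<in> A"
  shows "ucharpoly L A = ucharpoly L (A - {H}) + ucharpoly H (restrict_arrangement A H)"
  by (rule ucharpoly_eqI[OF assms(1) deletion_restriction[OF assms
        is_ucharpoly_ucharpoly[OF arrangement_delete[OF assms]]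
        is_ucharpoly_ucharpoly[OF arrangement_restrict[OF assms]]]])

end

theory Submission
  imports Defs
begin

text \<open>A fan valuation cannot see more of an arrangement than the deletion-restriction recursion
  sees. Let \<open>H\<close> be one hyperplane of \<open>\<A>\<close>, and cut two fans by \<open>H\<close>: the fan of \<open>\<A> - {H}\<close>
  and the fan of \<open>\<A>\<close> itself. On either side of \<open>H\<close> both leave the same cones. On \<open>H\<close> the first
  leaves the fan of \<open>\<A>/H\<close>, and the second leaves nothing, because \<open>H\<close> meets no relative interior of
  a chamber of \<open>\<A>\<close>. Subtracting the two instances of the valuation property
  gives \<open>\<phi>(\<A>) = \<phi>(\<A> - {H}) + \<phi>(\<A>/H)\<close> (\<open>arrangement_fan_deletion_restriction\<close>), which is the
  recursion of the unsigned characteristic polynomial.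

  Hence \<open>\<phi>\<close> is an additive function of that polynomial as soon as this is so for singletons. By
  invariance, \<open>\<phi>\<close> takes one value \<open>c k\<close> on all \<open>k\<close>-singletons
  (\<open>rotation_invariant_singleton\<close>), and their polynomial is \<open>t\<^sup>k + t\<^bsup>k-1\<^esup>\<close>. So the coefficients
  must satisfy \<open>a k + a (k - 1) = c k\<close> for \<open>1 \<le> k \<le> d\<close>. The formula
  ignores the coefficient of \<open>t\<^sup>d\<close>, which amounts to \<open>a d = 0\<close>; starting from there the system is
  solved downwards, in exactly one way. This gives existence and uniqueness at once.\<close>

section \<open>Chambers of an arrangement given by normal vectors\<close>

text \<open>An arrangement in \<open>L\<close> is described by a finite set \<open>U\<close> of normal vectors rather than by its
  hyperplanes: the same \<open>U\<close> then describes the restriction to a hyperplane of \<open>L\<close>, where several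
  normals may cut out the same subspace and need not lie in the restricted space. A chamber is
  recorded by one of its points, so that no choice of sign vectors is needed.\<close>

definition regular_points :: "'a::euclidean_space set \<Rightarrow> 'a set \<Rightarrow> 'a set" where
  "regular_points L U = {x \<in> L. \<forall>u\<in>U. u \<bullet> x \<noteq> 0}"

definition chamber :: "'a::euclidean_space set \<Rightarrow> 'a set \<Rightarrow> 'a \<Rightarrow> 'a set" where
  "chamber L U x = {y \<in> L. \<forall>u\<in>U. 0 < (u \<bullet> x) * (u \<bullet> y)}"

definition closed_chamber :: "'a::euclidean_space set \<Rightarrow> 'a set \<Rightarrow> 'a \<Rightarrow> 'a set" where
  "closed_chamber L U x = {y \<in> L. \<forall>u\<in>U. 0 \<le> (u \<bullet> x) * (u \<bullet> y)}"

definition chamber_fan :: "'a::euclidean_space set \<Rightarrow> 'a set \<Rightarrow> 'a set set" where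
  "chamber_fan L U = closed_chamber L U ` regular_points L U"

lemma mem_chamber: "x \<in> regular_points L U \<Longrightarrow> x \<in> chamber L U x"
  by (auto simp: regular_points_def chamber_def zero_less_mult_iff linorder_neq_iff)

lemma chamber_subset_regular: "chamber L U x \<subseteq> regular_points L U"
  by (auto simp: regular_points_def chamber_def)

lemma chamber_subset_closed: "chamber L U x \<subseteq> closed_chamber L U x"
  by (auto simp: chamber_def closed_chamber_def less_imp_le)

lemma closed_chamber_eq: "y \<in> chamber L U x \<Longrightarrow> closed_chamber L U y = closed_chamber L U x"
  by (intro set_eqI, simp add: chamber_def closed_chamber_def zero_less_mult_iff zero_le_mult_iff) (smt (verit))

lemma chamber_alt: "chamber L U x = L \<inter> (\<Inter>u\<in>U. {y. ((u \<bullet> x) *\<^sub>R u) \<bullet> y > 0})"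
  by (auto simp: chamber_def)

lemma closed_chamber_alt: "closed_chamber L U x = L \<inter> (\<Inter>u\<in>U. {y. ((u \<bullet> x) *\<^sub>R u) \<bullet> y \<ge> 0})"
  by (auto simp: closed_chamber_def)

lemma convex_chamber: "subspace L \<Longrightarrow> convex (chamber L U x)"
  unfolding chamber_alt
  by (intro convex_Int convex_INT convex_halfspace_gt subspace_imp_convex)

lemma openin_chamber: "finite U \<Longrightarrow> openin (top_of_set L) (chamber L U x)"
  unfolding chamber_alt
  by (intro openin_open_Int open_INT ballI open_halfspace_gt)

lemma closed_closed_chamber: "subspace L \<Longrightarrow> closed (closed_chamber L U x)"
  unfolding closed_chamber_alt
  by (intro closed_Int closed_INT ballI closed_halfspace_ge closed_subspace)

text \<open>A linear functional without zeros on a connected set keeps its sign there, and a chamber is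
  convex; so the chambers are exactly the maximal connected sets.\<close>
lemma components_regular_points:
  assumes "subspace L"
  shows "components (regular_points L U) = chamber L U ` regular_points L U"
proof -
  have "connected_component_set (regular_points L U) x = chamber L U x"
    if x: "x \<in> regular_points L U" for x
  proof (rule connected_component_unique)
    show "x \<in> chamber L U x" using x by (rule mem_chamber)
    show "chamber L U x \<subseteq> regular_points L U" by (rule chamber_subset_regular)
    show "connected (chamber L U x)" using assms by (simp add: convex_chamber convex_connected)
    fix T assume T: "x \<in> T" "T \<subseteq> regular_points L U" "connected T"
    show "T \<subseteq> chamber L U x"
    proof
      fix y assume y: "y \<in> T"
      have "0 < (u \<bullet> x) * (u \<bullet> y)" if u: "u \<in> U" for u
      proof -
        have "connected ((\<lambda>z. u \<bullet> z) ` T)"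
          by (intro connected_continuous_image T(3) continuous_intros)
        moreover have "0 \<notin> (\<lambda>z. u \<bullet> z) ` T" using T(2) u by (auto simp: regular_points_def)
        moreover have "u \<bullet> x \<in> (\<lambda>z. u \<bullet> z) ` T" "u \<bullet> y \<in> (\<lambda>z. u \<bullet> z) ` T"
          using T(1) y by auto
        ultimately show ?thesis
          unfolding zero_less_mult_iff using connectedD_interval[of _ "u \<bullet> x" "u \<bullet> y" 0]
            connectedD_interval[of _ "u \<bullet> y" "u \<bullet> x" 0] by (smt (verit))
      qed
      then show "y \<in> chamber L U x" using y T(2) by (auto simp: chamber_def regular_points_def)
    qed
  qed
  then show ?thesis by (auto simp: components_def)
qed

text \<open>Adding a small multiple of the base point \<open>x\<close> moves any point of the closed chamber into the
  open one.\<close>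
lemma closure_chamber:
  assumes L: "subspace L" and x: "x \<in> regular_points L U"
  shows "closure (chamber L U x) = closed_chamber L U x"
proof
  show "closure (chamber L U x) \<subseteq> closed_chamber L U x"
    using L by (intro closure_minimal chamber_subset_closed closed_closed_chamber)
  show "closed_chamber L U x \<subseteq> closure (chamber L U x)"
  proof
    fix y assume y: "y \<in> closed_chamber L U x"
    let ?z = "\<lambda>n. y + inverse (real (Suc n)) *\<^sub>R x"
    have "?z n \<in> chamber L U x" for n
    proof -
      have "?z n \<in> L" using L x y
        by (auto simp: regular_points_def closed_chamber_def intro: subspace_add subspace_mul)
      moreover have "0 < (u \<bullet> x) * (u \<bullet> ?z n)" if "u \<in> U" for u
      proof -
        have "0 \<le> (u \<bullet> x) * (u \<bullet> y)" "0 < (u \<bullet> x) * (u \<bullet> x)"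
          using x y that mem_chamber[OF x] by (auto simp: closed_chamber_def chamber_def)
        moreover have "(u \<bullet> x) * (u \<bullet> ?z n) = (u \<bullet> x) * (u \<bullet> y) + inverse (real (Suc n)) * ((u \<bullet> x) * (u \<bullet> x))"
          by (simp add: inner_add_right algebra_simps)
        ultimately show ?thesis by (simp add: add_nonneg_pos)
      qed
      ultimately show ?thesis by (simp add: chamber_def)
    qed
    moreover have "?z \<longlonglongrightarrow> y + 0 *\<^sub>R x"
      by (intro tendsto_intros LIMSEQ_inverse_real_of_nat)
    ultimately show "y \<in> closure (chamber L U x)"
      unfolding closure_sequential by (intro exI[of _ ?z]) auto
  qed
qed

lemma arrangement_fan_eq_chamber_fan:
  assumes "subspace L" "A = (\<lambda>u. {x \<in> L. u \<bullet> x = 0}) ` U"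
  shows "arrangement_fan L A = chamber_fan L U"
proof -
  have "L - \<Union>A = regular_points L U" unfolding assms(2) regular_points_def by auto
  then show ?thesis using assms(1)
    by (simp add: arrangement_fan_def chamber_fan_def components_regular_points image_image closure_chamber)
qed

lemma affine_hull_chamber:
  assumes "subspace L" "finite U" "x \<in> regular_points L U"
  shows "affine hull (chamber L U x) = L"
proof -
  have aff: "affine hull L = L" using assms(1) by (simp add: subspace_imp_affine)
  have "affine hull (chamber L U x) = affine hull L"
    using affine_hull_openin[of L "chamber L U x"] openin_chamber[OF assms(2), of L x] mem_chamber[OF assms(3)]
    by (auto simp: aff)
  then show ?thesis by (simp add: aff)
qed

text \<open>A convex set and its closure have the same relative interior, and a nonempty chamber is already
  open in \<open>L\<close>. This is what turns the condition \<open>relint(C) \<inter> S \<noteq> \<emptyset>\<close> in the sections of a fan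
  into a condition on open chambers.\<close>
lemma rel_interior_closed_chamber:
  assumes "subspace L" "finite U" "x \<in> regular_points L U"
  shows "rel_interior (closed_chamber L U x) = chamber L U x"
proof -
  have "rel_interior (closed_chamber L U x) = rel_interior (chamber L U x)"
    unfolding closure_chamber[OF assms(1,3), symmetric]
    by (rule convex_rel_interior_closure[OF convex_chamber[OF assms(1)]])
  also have "\<dots> = chamber L U x"
    by (simp add: rel_interior_eq affine_hull_chamber[OF assms] openin_chamber[OF assms(2)])
  finally show ?thesis .
qed

lemma span_closed_chamber:
  assumes "subspace L" "finite U" "x \<in> regular_points L U"
  shows "span (closed_chamber L U x) = L"
proof
  show "span (closed_chamber L U x) \<subseteq> L"
    by (rule span_minimal) (use assms(1) in \<open>auto simp: closed_chamber_def\<close>)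
  have "affine hull (chamber L U x) \<subseteq> affine hull (closed_chamber L U x)"
    by (intro hull_mono chamber_subset_closed)
  then show "L \<subseteq> span (closed_chamber L U x)"
    using affine_hull_subset_span affine_hull_chamber[OF assms] by blast
qed

section \<open>The closed chambers form a fan\<close>

text \<open>The one-dimensional core of the face property: \<open>a\<close> and \<open>b\<close> lie weakly on the same side of \<open>0\<close>
  (that of \<open>p\<close>), so if \<open>q\<close> disagrees with \<open>b\<close> it cannot strictly agree with \<open>a\<close>.\<close>
lemma opposite_sign_transfer:
  fixes p q a b :: real
  assumes "q * b < 0" "0 \<le> p * b" "0 \<le> p * a" "p \<noteq> 0"
  shows "q * a \<le> 0"
proof (cases "0 < p")
  case True
  then have "0 \<le> b" "0 \<le> a" using assms by (auto simp: zero_le_mult_iff)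
  then show ?thesis using assms(1) by (auto simp: mult_less_0_iff mult_le_0_iff)
next
  case False
  then have "b \<le> 0" "a \<le> 0" using assms by (auto simp: zero_le_mult_iff)
  then show ?thesis using assms(1) by (auto simp: mult_less_0_iff mult_le_0_iff)
qed

text \<open>A normal whose hyperplane separates the two chambers vanishes on their intersection. On a segment
  in the first cone its values have one sign, so if it vanishes at an inner point it vanishes at both
  ends.\<close>
lemma closed_chamber_Int_face:
  assumes L: "subspace L" and x: "x \<in> regular_points L U" and x': "x' \<in> regular_points L U"
  shows "(closed_chamber L U x \<inter> closed_chamber L U x') face_of closed_chamber L U x"
  unfolding face_of_def
proof (intro conjI ballI impI)
  show "convex (closed_chamber L U x \<inter> closed_chamber L U x')"
    using L x x' by (metis closure_chamber convex_Int convex_chamber convex_closure)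
  have key: "b \<in> closed_chamber L U x'"
    if ab: "a \<in> closed_chamber L U x" "b \<in> closed_chamber L U x"
      and z: "z \<in> closed_chamber L U x'" "z \<in> open_segment a b" for a b z
  proof -
    obtain t where t: "0 < t" "t < 1" and zt: "z = (1 - t) *\<^sub>R a + t *\<^sub>R b"
      using z(2) by (auto simp: in_segment)
    have "0 \<le> (u \<bullet> x') * (u \<bullet> b)" if u: "u \<in> U" for u
    proof (rule ccontr)
      assume "\<not> 0 \<le> (u \<bullet> x') * (u \<bullet> b)"
      then have neg: "(u \<bullet> x') * (u \<bullet> b) < 0" by simp
      moreover have "0 \<le> (u \<bullet> x) * (u \<bullet> b)" "0 \<le> (u \<bullet> x) * (u \<bullet> a)" "u \<bullet> x \<noteq> 0"
        using ab u x by (auto simp: closed_chamber_def regular_points_def)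
      ultimately have "(u \<bullet> x') * (u \<bullet> a) \<le> 0"
        by (rule opposite_sign_transfer)
      then have "(1 - t) * ((u \<bullet> x') * (u \<bullet> a)) + t * ((u \<bullet> x') * (u \<bullet> b)) < 0"
        using mult_nonneg_nonpos[of "1 - t"] mult_pos_neg[OF t(1) neg] t by (meson add_nonpos_neg diff_ge_0_iff_ge less_imp_le)
      moreover have "(u \<bullet> x') * (u \<bullet> z) = (1 - t) * ((u \<bullet> x') * (u \<bullet> a)) + t * ((u \<bullet> x') * (u \<bullet> b))"
        by (simp add: zt inner_add_right algebra_simps)
      ultimately show False using z(1) u by (auto simp: closed_chamber_def)
    qed
    then show ?thesis using ab by (auto simp: closed_chamber_def)
  qed
  fix a b z assume ab: "a \<in> closed_chamber L U x" "b \<in> closed_chamber L U x"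
    and z: "z \<in> closed_chamber L U x \<inter> closed_chamber L U x'" "z \<in> open_segment a b"
  show "a \<in> closed_chamber L U x \<inter> closed_chamber L U x'"
    using key[of b a z] ab z by (auto simp: open_segment_commute)
  show "b \<in> closed_chamber L U x \<inter> closed_chamber L U x'"
    using key[of a b z] ab z by auto
qed auto

text \<open>A cone of the fan is determined by the set of normals that are positive at its base point.\<close>
lemma finite_chamber_fan:
  assumes "finite U" shows "finite (chamber_fan L U)"
proof -
  let ?C = "\<lambda>V. {y \<in> L. \<forall>u\<in>U. if u \<in> V then 0 \<le> u \<bullet> y else u \<bullet> y \<le> 0}"
  have "closed_chamber L U x \<in> ?C ` Pow U" if x: "x \<in> regular_points L U" for x
  proof (rule image_eqI)
    have "0 \<le> (u \<bullet> x) * (u \<bullet> y) \<longleftrightarrow> (if 0 < u \<bullet> x then 0 \<le> u \<bullet> y else u \<bullet> y \<le> 0)"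
      if "u \<in> U" for u y
      using x that by (auto simp: regular_points_def zero_le_mult_iff)
    then show "closed_chamber L U x = ?C {u \<in> U. 0 < u \<bullet> x}"
      by (simp add: closed_chamber_def)
  qed simp
  then have "chamber_fan L U \<subseteq> ?C ` Pow U" unfolding chamber_fan_def by (rule image_subsetI)
  then show ?thesis using assms by (meson finite_Pow_iff finite_imageI finite_subset)
qed

lemma polyhedral_cone_closed_chamber:
  assumes "subspace L" "finite U"
  shows "polyhedral_cone (closed_chamber L U x)"
proof -
  have "polyhedron L" using assms(1) by (intro affine_imp_polyhedron subspace_imp_affine)
  moreover have "polyhedron (\<Inter>u\<in>U. {y. ((u \<bullet> x) *\<^sub>R u) \<bullet> y \<ge> 0})"
    using assms(2) by (intro polyhedron_Inter) (auto intro: polyhedron_halfspace_ge simp del: inner_scaleR_left)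
  ultimately have "polyhedron (closed_chamber L U x)"
    unfolding closed_chamber_alt by (rule polyhedron_Int)
  moreover have "cone (closed_chamber L U x)"
    using assms(1) by (auto simp: cone_def closed_chamber_def subspace_mul mult.left_commute)
  moreover have "0 \<in> closed_chamber L U x"
    using assms(1) by (auto simp: closed_chamber_def subspace_0)
  ultimately show ?thesis by (auto simp: polyhedral_cone_def)
qed

lemma fan_chamber_fan:
  assumes "subspace L" "finite U"
  shows "fan (chamber_fan L U)"
  unfolding fan_def using assms
  by (auto simp: finite_chamber_fan)
    (auto simp: chamber_fan_def polyhedral_cone_closed_chamber closed_chamber_Int_face
      span_closed_chamber)

lemma fan_lin_chamber_fan:
  assumes "subspace L" "finite U" "chamber_fan L U \<noteq> {}"
  shows "fan_lin (chamber_fan L U) = L"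
proof -
  obtain C where C: "C \<in> chamber_fan L U" using assms(3) by blast
  then have "fan_lin (chamber_fan L U) = span C"
    by (rule fan_lin_eq[OF fan_chamber_fan[OF assms(1,2)]])
  also have "\<dots> = L"
    using C span_closed_chamber[OF assms(1,2)] by (auto simp: chamber_fan_def)
  finally show ?thesis .
qed

section \<open>Sections of the fan and deletion-restriction\<close>

lemma hyperplane_normal_not_orthogonal:
  assumes "hyperplane_in L H" "H = {x \<in> L. u \<bullet> x = 0}" "subspace L"
  obtains v where "v \<in> L" "u \<bullet> v < 0"
proof -
  have "H \<noteq> L" using assms(1) by (auto simp: hyperplane_in_def)
  then obtain w where w: "w \<in> L" "u \<bullet> w \<noteq> 0" using assms(2) by auto
  show ?thesis
  proof (cases "u \<bullet> w < 0")
    case True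
    then show ?thesis using that w by blast
  next
    case False
    then show ?thesis using that[of "- w"] w assms(3) by (auto simp: subspace_neg)
  qed
qed

text \<open>Chambers are relatively open, so a chamber touching a halfspace only along its boundary can be
  entered a little further. Thus it does not matter that the sections of a fan use closed halfspaces.\<close>
lemma chamber_meets_open_halfspace:
  assumes L: "subspace L" and U: "finite U" and y: "y \<in> chamber L U x" "u \<bullet> y \<le> 0"
    and v: "v \<in> L" "u \<bullet> v < 0"
  obtains z where "z \<in> chamber L U x" "u \<bullet> z < 0"
proof -
  obtain e where e: "0 < e" "ball y e \<inter> L \<subseteq> chamber L U x"
    using openin_chamber[OF U, of L x] y(1) unfolding openin_contains_ball by blast
  have v0: "0 < norm v" using v(2) by auto
  \<comment> \<open>The step \<open>t *\<^sub>R v\<close> has length \<open>e / 2\<close>, so it stays inside the ball.\<close>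
  define t where "t = e / 2 / norm v"
  have t: "0 < t" using e v0 by (simp add: t_def)
  have "y \<in> L" using y(1) by (simp add: chamber_def)
  then have "y + t *\<^sub>R v \<in> L" using v(1) L by (simp add: subspace_add subspace_mul)
  moreover have "y + t *\<^sub>R v \<in> ball y e" using e v0 by (simp add: dist_norm t_def)
  ultimately have "y + t *\<^sub>R v \<in> chamber L U x" using e(2) by blast
  moreover have "u \<bullet> (y + t *\<^sub>R v) < 0"
    using y(2) mult_pos_neg[OF t v(2)] by (simp add: inner_add_right)
  ultimately show ?thesis using that by blast
qed

lemma chamber_insert:
  "chamber L (insert u U) y = {z \<in> chamber L U y. 0 < (u \<bullet> y) * (u \<bullet> z)}"
  by (auto simp: chamber_def)

lemma closed_chamber_insert:
  "closed_chamber L (insert u U) y = {z \<in> closed_chamber L U y. 0 \<le> (u \<bullet> y) * (u \<bullet> z)}"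
  by (auto simp: closed_chamber_def)

lemma regular_points_insert:
  "regular_points L (insert u U) = {x \<in> regular_points L U. u \<bullet> x \<noteq> 0}"
  by (auto simp: regular_points_def)

lemma fan_section_chamber_fan:
  assumes "subspace L" "finite U"
  shows "fan_section (chamber_fan L U) S =
    {closed_chamber L U y \<inter> S | y. y \<in> regular_points L U \<and> chamber L U y \<inter> S \<noteq> {}}"
  unfolding fan_section_def chamber_fan_def
  using rel_interior_closed_chamber[OF assms] by auto

text \<open>The right-hand side depends on \<open>U\<close> only through \<open>insert u U\<close>. Hence the arrangements with and
  without the hyperplane \<open>{x. u \<bullet> x = 0}\<close> have the same section by a halfspace that this hyperplane bounds.\<close>
lemma fan_section_halfspace:
  assumes L: "subspace L" and U: "finite U" and v: "v \<in> L" "u \<bullet> v < 0"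
  shows "fan_section (chamber_fan L U) {x \<in> L. u \<bullet> x \<le> 0} =
    closed_chamber L (insert u U) ` {y \<in> regular_points L (insert u U). u \<bullet> y < 0}"
    (is "fan_section _ ?S = ?R")
proof -
  have cut: "closed_chamber L U y \<inter> ?S = closed_chamber L (insert u U) y" if "u \<bullet> y < 0" for y
    using that by (auto simp: closed_chamber_def zero_le_mult_iff)
  show ?thesis
  proof
    show "fan_section (chamber_fan L U) ?S \<subseteq> ?R"
    proof
      fix C assume "C \<in> fan_section (chamber_fan L U) ?S"
      then obtain y w where y: "y \<in> regular_points L U" "C = closed_chamber L U y \<inter> ?S"
        and w: "w \<in> chamber L U y" "u \<bullet> w \<le> 0"
        unfolding fan_section_chamber_fan[OF L U] by blast
      obtain z where z: "z \<in> chamber L U y" "u \<bullet> z < 0"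
        using chamber_meets_open_halfspace[OF L U w v] by blast
      have "C = closed_chamber L (insert u U) z"
        using y(2) closed_chamber_eq[OF z(1)] cut[OF z(2)] by simp
      moreover have "z \<in> regular_points L (insert u U)"
        using z chamber_subset_regular by (fastforce simp: regular_points_insert)
      ultimately show "C \<in> ?R" using z(2) by blast
    qed
    show "?R \<subseteq> fan_section (chamber_fan L U) ?S"
    proof
      fix C assume "C \<in> ?R"
      then obtain y where y: "y \<in> regular_points L (insert u U)" "u \<bullet> y < 0"
        "C = closed_chamber L (insert u U) y" by blast
      then have reg: "y \<in> regular_points L U" "y \<in> L" by (auto simp: regular_points_def)
      then have "y \<in> chamber L U y \<inter> ?S" using mem_chamber y(2) by fastforce
      then show "C \<in> fan_section (chamber_fan L U) ?S"
        unfolding fan_section_chamber_fan[OF L U] using cut[OF y(2)] y(3) reg by blast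
    qed
  qed
qed

lemma chamber_fan_insert_uminus: "chamber_fan L (insert (- u) U) = chamber_fan L (insert u U)"
  unfolding chamber_fan_def closed_chamber_insert regular_points_insert by simp

lemma fan_section_insert_halfspace:
  assumes "subspace L" "finite U" "v \<in> L" "u \<bullet> v < 0"
  shows "fan_section (chamber_fan L (insert u U)) {x \<in> L. u \<bullet> x \<le> 0}
       = fan_section (chamber_fan L U) {x \<in> L. u \<bullet> x \<le> 0}"
  using assms by (simp add: fan_section_halfspace)

lemma fan_section_insert_halfspace_ge:
  assumes "subspace L" "finite U" "v \<in> L" "u \<bullet> v < 0"
  shows "fan_section (chamber_fan L (insert u U)) {x \<in> L. u \<bullet> x \<ge> 0}
       = fan_section (chamber_fan L U) {x \<in> L. u \<bullet> x \<ge> 0}"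
  using fan_section_insert_halfspace[OF assms(1,2), of "- v" "- u"] assms
  by (simp add: chamber_fan_insert_uminus subspace_neg)

text \<open>Once \<open>u\<close> is among the normals, no open chamber meets its hyperplane.\<close>
lemma fan_section_insert_hyperplane:
  assumes "subspace L" "finite U"
  shows "fan_section (chamber_fan L (insert u U)) {x \<in> L. u \<bullet> x = 0} = {}"
  using assms by (auto simp: fan_section_chamber_fan chamber_insert)

text \<open>A chamber that meets the hyperplane is the chamber of any common point, and that point serves as
  the base point of the corresponding chamber in the hyperplane.\<close>
lemma fan_section_hyperplane:
  assumes "subspace L" "finite U"
  shows "fan_section (chamber_fan L U) {x \<in> L. u \<bullet> x = 0} = chamber_fan {x \<in> L. u \<bullet> x = 0} U"
    (is "fan_section _ ?H = _")
proof -
  have cut: "closed_chamber L U y \<inter> ?H = closed_chamber ?H U y" for y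
    by (auto simp: closed_chamber_def)
  show ?thesis
  proof
    show "fan_section (chamber_fan L U) ?H \<subseteq> chamber_fan ?H U"
    proof
      fix C assume "C \<in> fan_section (chamber_fan L U) ?H"
      then obtain y w where "C = closed_chamber L U y \<inter> ?H" and w: "w \<in> chamber L U y" "w \<in> ?H"
        unfolding fan_section_chamber_fan[OF assms] by blast
      then have "C = closed_chamber ?H U w"
        unfolding cut[symmetric] by (simp add: closed_chamber_eq[OF w(1)])
      moreover have "w \<in> regular_points ?H U"
        using w chamber_subset_regular by (fastforce simp: regular_points_def)
      ultimately show "C \<in> chamber_fan ?H U" by (simp add: chamber_fan_def)
    qed
    show "chamber_fan ?H U \<subseteq> fan_section (chamber_fan L U) ?H"
    proof
      fix C assume "C \<in> chamber_fan ?H U"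
      then obtain y where y: "y \<in> regular_points ?H U" "C = closed_chamber ?H U y"
        by (auto simp: chamber_fan_def)
      then have reg: "y \<in> regular_points L U" "y \<in> ?H" by (auto simp: regular_points_def)
      then have "y \<in> chamber L U y \<inter> ?H" using mem_chamber by fastforce
      then show "C \<in> fan_section (chamber_fan L U) ?H"
        unfolding fan_section_chamber_fan[OF assms] using cut y(2) reg by blast
    qed
  qed
qed

text \<open>The empty fan has to be treated apart because its linear hull is \<open>{0}\<close> instead of \<open>L\<close>; there
  both sides vanish.\<close>
lemma fan_valuation_chamber_fan:
  assumes \<phi>: "fan_valuation \<phi>" and L: "subspace L" and U: "finite U"
    and H: "hyperplane_in L H" "H = {x \<in> L. u \<bullet> x = 0}"
  shows "\<phi> (chamber_fan L U) = \<phi> (fan_section (chamber_fan L U) {x \<in> L. u \<bullet> x \<le> 0})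
            + \<phi> (fan_section (chamber_fan L U) {x \<in> L. u \<bullet> x \<ge> 0})
            - \<phi> (fan_section (chamber_fan L U) H)"
proof (cases "chamber_fan L U = {}")
  case True
  then show ?thesis using \<phi> by (simp add: fan_section_def fan_valuation_def)
next
  case False
  have lin: "fan_lin (chamber_fan L U) = L" by (rule fan_lin_chamber_fan[OF L U False])
  have "fan (chamber_fan L U)" by (rule fan_chamber_fan[OF L U])
  moreover have "hyperplane_in (fan_lin (chamber_fan L U)) H"
    "H = {x \<in> fan_lin (chamber_fan L U). u \<bullet> x = 0}"
    unfolding lin by (rule H)+
  ultimately have "\<phi> (chamber_fan L U) =
      \<phi> (fan_section (chamber_fan L U) {x \<in> fan_lin (chamber_fan L U). u \<bullet> x \<le> 0})
    + \<phi> (fan_section (chamber_fan L U) {x \<in> fan_lin (chamber_fan L U). u \<bullet> x \<ge> 0})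
    - \<phi> (fan_section (chamber_fan L U) H)"
    using \<phi> False unfolding fan_valuation_def by blast
  then show ?thesis by (simp only: lin)
qed

text \<open>Cutting the fans of \<open>insert u U\<close> and of \<open>U\<close> by the same hyperplane gives the same two halves,
  and the sections by the hyperplane itself are empty and the restricted fan, respectively.\<close>
proposition fan_valuation_deletion_restriction:
  assumes \<phi>: "fan_valuation \<phi>" and L: "subspace L" and U: "finite U"
    and H: "hyperplane_in L H" "H = {x \<in> L. u \<bullet> x = 0}"
  shows "\<phi> (chamber_fan L (insert u U)) = \<phi> (chamber_fan L U) + \<phi> (chamber_fan H U)"
proof -
  obtain v where v: "v \<in> L" "u \<bullet> v < 0"
    using hyperplane_normal_not_orthogonal[OF H L] by blast
  have "\<phi> (chamber_fan L (insert u U)) =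
      \<phi> (fan_section (chamber_fan L U) {x \<in> L. u \<bullet> x \<le> 0})
    + \<phi> (fan_section (chamber_fan L U) {x \<in> L. u \<bullet> x \<ge> 0})"
    using fan_valuation_chamber_fan[OF \<phi> L _ H, of "insert u U"] U \<phi>
    by (simp add: H(2) fan_valuation_def fan_section_insert_hyperplane[OF L U]
        fan_section_insert_halfspace[OF L U v] fan_section_insert_halfspace_ge[OF L U v])
  moreover have "\<phi> (chamber_fan L U) =
      \<phi> (fan_section (chamber_fan L U) {x \<in> L. u \<bullet> x \<le> 0})
    + \<phi> (fan_section (chamber_fan L U) {x \<in> L. u \<bullet> x \<ge> 0}) - \<phi> (chamber_fan H U)"
    using fan_valuation_chamber_fan[OF \<phi> L U H] by (simp add: H(2) fan_section_hyperplane[OF L U])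
  ultimately show ?thesis by (simp add: algebra_simps)
qed

lemma hyperplane_normal_exists:
  assumes "subspace L" "hyperplane_in L H"
  shows "\<exists>u\<in>L. u \<noteq> 0 \<and> H = {x \<in> L. u \<bullet> x = 0}"
proof -
  have H: "subspace H" "H \<subseteq> L" "dim L = dim H + 1" using assms(2) by (auto simp: hyperplane_in_def)
  then have "H \<subset> L" by auto
  then have "span H \<subset> span L" using H(1) assms(1) by (metis span_eq_iff)
  then obtain u where u: "u \<noteq> 0" "u \<in> L" "\<And>y. y \<in> H \<Longrightarrow> orthogonal u y"
    using orthogonal_to_subspace_exists_gen[of H L] assms(1) H(1) by (metis span_eq_iff span_base)
  let ?K = "{x \<in> L. u \<bullet> x = 0}"
  have K: "subspace ?K" using assms(1) by (auto simp: subspace_def inner_add_right)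
  have HK: "H \<subseteq> ?K" using u(3) H(2) by (auto simp: orthogonal_def)
  have "u \<notin> ?K" using u(1) by simp
  then have "?K \<noteq> L" using u(2) by blast
  then have "dim ?K \<noteq> dim L" using subspace_dim_equal[OF K assms(1)] by auto
  moreover have "dim ?K \<le> dim L" by (rule dim_subset) auto
  ultimately have "H = ?K" using H HK by (intro subspace_dim_equal[OF H(1) K]) auto
  then show ?thesis using u(1,2) by blast
qed

text \<open>The normals of the remaining hyperplanes describe both the deletion, as functionals on \<open>L\<close>, and
  the restriction, as functionals on \<open>H\<close>.\<close>
proposition arrangement_fan_deletion_restriction:
  assumes \<phi>: "fan_valuation \<phi>" and A: "arrangement L A" and H: "H \<in> A"
  shows "\<phi> (arrangement_fan L A) =
    \<phi> (arrangement_fan L (A - {H})) + \<phi> (arrangement_fan H (restrict_arrangement A H))"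
proof -
  have L: "subspace L" and fin: "finite A" and hyp: "\<And>K. K \<in> A \<Longrightarrow> hyperplane_in L K"
    using A by (auto simp: arrangement_def)
  then obtain \<nu> where \<nu>: "\<And>K. K \<in> A \<Longrightarrow> K = {x \<in> L. \<nu> K \<bullet> x = 0}"
    using hyperplane_normal_exists[OF L] by metis
  let ?U = "\<nu> ` (A - {H})"
  have hyps: "B = (\<lambda>u. {x \<in> L. u \<bullet> x = 0}) ` \<nu> ` B" if "B \<subseteq> A" for B
    using that \<nu> by (force simp: image_image)
  have HL: "subspace H" "H \<subseteq> L" using hyp[OF H] by (auto simp: hyperplane_in_def)
  have "\<phi> (chamber_fan L (insert (\<nu> H) ?U)) = \<phi> (chamber_fan L ?U) + \<phi> (chamber_fan H ?U)"
    by (rule fan_valuation_deletion_restriction[OF \<phi> L _ hyp[OF H] \<nu>[OF H]]) (use fin in simp)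
  moreover have "insert (\<nu> H) ?U = \<nu> ` A" using H by auto
  moreover have "arrangement_fan L A = chamber_fan L (\<nu> ` A)"
    by (rule arrangement_fan_eq_chamber_fan[OF L hyps]) simp
  moreover have "arrangement_fan L (A - {H}) = chamber_fan L ?U"
    by (rule arrangement_fan_eq_chamber_fan[OF L hyps]) auto
  moreover have "arrangement_fan H (restrict_arrangement A H) = chamber_fan H ?U"
  proof (rule arrangement_fan_eq_chamber_fan[OF HL(1)])
    have "K \<inter> H = {x \<in> H. \<nu> K \<bullet> x = 0}" if "K \<in> A" for K
      using \<nu>[OF that] HL(2) by auto
    then show "restrict_arrangement A H = (\<lambda>u. {x \<in> H. u \<bullet> x = 0}) ` ?U"
      by (simp add: restrict_arrangement_def image_image)
  qed
  ultimately show ?thesis by simp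
qed

section \<open>Rotations between subspaces with a distinguished vector\<close>

definition reflection :: "'a::euclidean_space \<Rightarrow> 'a \<Rightarrow> 'a" where
  "reflection v x = x - (2 * (v \<bullet> x) / (v \<bullet> v)) *\<^sub>R v"

lemma linear_reflection: "linear (reflection v)"
  by (rule linearI) (simp_all add: reflection_def inner_add_right algebra_simps add_divide_distrib)

lemma reflection_involution: "reflection v (reflection v x) = x"
  by (cases "v = 0") (simp_all add: reflection_def inner_diff_right)

lemma orthogonal_transformation_reflection: "orthogonal_transformation (reflection v)"
  unfolding orthogonal_transformation_def
proof (intro conjI allI linear_reflection)
  fix x y
  show "reflection v x \<bullet> reflection v y = x \<bullet> y"
    by (cases "v = 0")
      (simp_all add: reflection_def inner_diff_left inner_diff_right inner_commute field_simps)
qed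

lemma reflection_image_subspace:
  assumes "subspace L" "v \<in> L"
  shows "reflection v ` L = L"
proof -
  have "reflection v x \<in> L" if "x \<in> L" for x
    using that assms by (simp add: reflection_def subspace_diff subspace_mul)
  then show ?thesis by (metis image_subsetI reflection_involution subsetI subset_antisym image_eqI)
qed

lemma reflection_self: "reflection v v = - v"
  by (cases "v = 0") (simp_all add: reflection_def scaleR_2)

text \<open>The mirror is the bisector of \<open>a\<close> and \<open>b\<close>.\<close>
lemma reflection_diff:
  assumes "norm a = norm b"
  shows "reflection (a - b) a = b"
proof (cases "a = b")
  case True
  then show ?thesis by (simp add: reflection_def)
next
  case False
  have "a \<bullet> a = b \<bullet> b" using assms by (simp add: norm_eq)
  then have "2 * ((a - b) \<bullet> a) = (a - b) \<bullet> (a - b)"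
    by (simp add: inner_diff_left inner_diff_right inner_commute)
  then have "2 * ((a - b) \<bullet> a) / ((a - b) \<bullet> (a - b)) = 1"
    using False by (metis divide_self inner_eq_zero_iff right_minus_eq)
  then show ?thesis unfolding reflection_def by (simp only: scaleR_one) simp
qed

lemma reflection_conjugate:
  assumes "orthogonal_transformation f"
  shows "reflection (f v) (f x) = f (reflection v x)"
  using assms by (simp add: reflection_def orthogonal_transformation_def linear_diff linear_cmul)

text \<open>Any two reflections are conjugate by an orthogonal map, so it suffices to compute the determinant
  for a coordinate reflection, whose matrix is diagonal.\<close>
lemma det_reflection:
  fixes v :: "real^'n"
  assumes "v \<noteq> 0"
  shows "det (matrix (reflection v)) = -1"
proof -
  obtain k :: 'n where True by simp
  let ?e = "norm v *\<^sub>R axis k 1 :: real^'n"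
  have "norm ?e = norm v" by simp
  then obtain f where f: "orthogonal_transformation f" "f ?e = v"
    using orthogonal_transformation_exists by metis
  let ?D = "matrix (reflection ?e)"
  have D: "?D $ i $ j = (if i = j then if i = k then -1 else 1 else 0)" for i j
  proof -
    have "axis k 1 \<bullet> (axis k 1 :: real^'n) = 1" by (simp add: inner_axis')
    then have "reflection ?e x = x - (2 * x $ k) *\<^sub>R axis k 1" for x
      using assms by (simp add: reflection_def inner_axis' power2_eq_square)
    then show ?thesis by (simp add: matrix_def axis_def)
  qed
  have "det ?D = (\<Prod>i\<in>UNIV. if i = k then -1 else 1)"
    by (subst det_diagonal) (auto simp: D)
  also have "\<dots> = -1" by (simp add: prod.delta)
  finally have D1: "det ?D = -1" .
  have lf: "linear f" using f(1) by (simp add: orthogonal_transformation_def)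
  have "reflection v \<circ> f = f \<circ> reflection ?e"
    using reflection_conjugate[OF f(1), of ?e] f(2) by auto
  then have "matrix (reflection v) ** matrix f = matrix f ** ?D"
    using lf linear_reflection by (metis matrix_compose)
  then have "det (matrix (reflection v)) * det (matrix f) = det (matrix f) * det ?D"
    by (metis det_mul)
  moreover have "det (matrix f) \<noteq> 0"
    using det_orthogonal_matrix[of "matrix f"] f(1) by (auto simp: orthogonal_transformation_matrix)
  moreover have "x = - 1" if "x * y = y * - 1" "y \<noteq> 0" for x y :: real
    using that by (metis mult.commute mult_cancel_right)
  ultimately show ?thesis by (simp only: D1)
qed

text \<open>An isometry between the subspaces and one between their orthogonal complements are glued along
  the orthogonal projection \<open>p\<close>.\<close>
lemma orthogonal_transformation_between_subspaces:
  fixes S T :: "'a::euclidean_space set"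
  assumes S: "subspace S" and T: "subspace T" and dim: "dim S = dim T"
  obtains g where "orthogonal_transformation g" "g ` S = T"
proof -
  define S' where "S' = {y. \<forall>x\<in>S. orthogonal x y}"
  define T' where "T' = {y. \<forall>x\<in>T. orthogonal x y}"
  have sub': "subspace S'" "subspace T'"
    unfolding S'_def T'_def by (simp_all add: subspace_orthogonal_to_vectors)
  have "dim S' + dim S = dim (UNIV :: 'a set)" "dim T' + dim T = dim (UNIV :: 'a set)"
    using dim_subspace_orthogonal_to_vectors[OF S subspace_UNIV]
      dim_subspace_orthogonal_to_vectors[OF T subspace_UNIV] by (simp_all add: S'_def T'_def)
  then have dim': "dim S' = dim T'" using dim by simp
  obtain f1 where f1: "linear f1" "f1 ` S = T" "\<And>x. x \<in> S \<Longrightarrow> norm (f1 x) = norm x"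
    using isometries_subspaces[OF S T dim] by metis
  obtain f2 where f2: "linear f2" "f2 ` S' = T'" "\<And>x. x \<in> S' \<Longrightarrow> norm (f2 x) = norm x"
    using isometries_subspaces[OF sub' dim'] by metis
  obtain B where B: "B \<subseteq> S" "pairwise orthogonal B" "span B = S"
    "\<And>x. x \<in> B \<Longrightarrow> norm x = 1" "independent B"
    using orthonormal_basis_subspace[OF S] by metis
  \<comment> \<open>The orthogonal projection onto \<open>S\<close>.\<close>
  define p where "p x = (\<Sum>b\<in>B. (b \<bullet> x / (b \<bullet> b)) *\<^sub>R b)" for x
  have lp: "linear p"
    unfolding p_def by (intro linear_compose_sum ballI linearI)
      (simp_all add: inner_add_right add_divide_distrib scaleR_add_left)
  have pS: "p x \<in> S" for x
    unfolding p_def using B(1) by (intro subspace_sum[OF S] subspace_mul[OF S]) auto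
  have pS': "x - p x \<in> S'" for x
    using Gram_Schmidt_step[OF B(2)] B(3) by (auto simp: S'_def p_def)
  have p_id: "p x = x" if "x \<in> S" for x
  proof -
    have "x - p x \<in> S" using that pS S by (simp add: subspace_diff)
    then have "orthogonal (x - p x) (x - p x)" using pS'[of x] by (simp add: S'_def)
    then show ?thesis by (simp add: orthogonal_self)
  qed
  define g where "g x = f1 (p x) + f2 (x - p x)" for x
  have "linear g"
    unfolding g_def using lp f1(1) f2(1)
    by (intro linearI) (simp_all add: linear_add linear_cmul linear_diff algebra_simps)
  moreover have "norm (g x) = norm x" for x
  proof -
    have "orthogonal (p x) (x - p x)" using pS pS' by (simp add: S'_def)
    then have "norm x ^ 2 = norm (p x) ^ 2 + norm (x - p x) ^ 2"
      using norm_add_Pythagorean[of "p x" "x - p x"] by simp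
    moreover have "orthogonal (f1 (p x)) (f2 (x - p x))"
      using pS[of x] pS'[of x] f1(2) f2(2) by (auto simp: T'_def)
    then have "norm (g x) ^ 2 = norm (p x) ^ 2 + norm (x - p x) ^ 2"
      unfolding g_def using norm_add_Pythagorean f1(3)[OF pS] f2(3)[OF pS'] by metis
    ultimately show ?thesis by (metis norm_ge_zero power2_eq_imp_eq)
  qed
  ultimately have "orthogonal_transformation g" by (simp add: orthogonal_transformation)
  moreover have "g ` S = T"
    using p_id f1(2) f2(1) by (force simp: g_def linear_0 image_iff)
  ultimately show ?thesis by (rule that)
qed

text \<open>Map \<open>L\<close> to \<open>L'\<close> orthogonally, then correct the image of \<open>u\<close> to \<open>u'\<close> by a reflection that
  preserves \<open>L'\<close>. If the result reverses orientation, one more reflection in \<open>u'\<close> makes it a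
  rotation. The price is the sign of \<open>u'\<close>, which keeps the statement true even in dimension one and
  which a hyperplane with normal \<open>u'\<close> does not see.\<close>
proposition rotation_between_pointed_subspaces:
  fixes L L' :: "(real^'n) set"
  assumes L: "subspace L" "subspace L'" "dim L = dim L'"
    and u: "u \<in> L" "u' \<in> L'" "norm u = norm u'" "u' \<noteq> 0"
  obtains Q where "rotation_matrix Q" "(*v) Q ` L = L'" "Q *v u = u' \<or> Q *v u = - u'"
proof -
  obtain f where f: "orthogonal_transformation f" "f ` L = L'"
    using orthogonal_transformation_between_subspaces[OF L] by blast
  define g where "g = reflection (f u - u') \<circ> f"
  have fu: "f u \<in> L'" using f(2) u(1) by blast
  have g: "orthogonal_transformation g"
    unfolding g_def by (rule orthogonal_transformation_compose[OF orthogonal_transformation_reflection f(1)])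
  have gL: "g ` L = L'"
    using reflection_image_subspace[OF L(2) subspace_diff[OF L(2) fu u(2)]] f(2)
    by (simp only: g_def image_comp [symmetric])
  have "norm (f u) = norm u'" using f(1) u(3) by (simp add: orthogonal_transformation_norm)
  then have gu: "g u = u'" by (simp add: g_def reflection_diff)
  have lg: "linear g" and og: "orthogonal_matrix (matrix g)"
    using g by (auto simp: orthogonal_transformation_matrix)
  have app: "(*v) (matrix h) = h" if "linear h" for h :: "real^'n \<Rightarrow> real^'n"
    using that by (rule matrix_vector_mul(2))
  show ?thesis
  proof (cases "rotation_matrix (matrix g)")
    case True
    then show ?thesis using gL gu by (intro that[of "matrix g"]) (simp_all only: app[OF lg] simp_thms)
  next
    case False
    then have d: "det (matrix g) = -1"
      using og by (metis orthogonal_rotation_or_rotoinversion rotoinversion_matrix_def)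
    define h where "h = reflection u' \<circ> g"
    have h: "orthogonal_transformation h"
      unfolding h_def by (rule orthogonal_transformation_compose[OF orthogonal_transformation_reflection g])
    have lh: "linear h" using h by (simp add: orthogonal_transformation_def)
    have "matrix h = matrix (reflection u') ** matrix g"
      unfolding h_def using lg linear_reflection by (rule matrix_compose)
    then have "det (matrix h) = 1" by (simp add: det_mul d det_reflection[OF u(4)])
    then have "rotation_matrix (matrix h)"
      using h by (simp add: rotation_matrix_def orthogonal_transformation_matrix)
    moreover have "h ` L = L'"
      using gL reflection_image_subspace[OF L(2) u(2)] by (simp only: h_def image_comp [symmetric])
    moreover have "h u = - u'" by (simp add: h_def gu reflection_self)
    ultimately show ?thesis by (intro that[of "matrix h"]) (simp_all only: app[OF lh] simp_thms)
  qed
qed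

section \<open>Invariant valuations on singletons\<close>

lemma chamber_fan_image:
  assumes "orthogonal_transformation f"
  shows "chamber_fan (f ` L) (f ` U) = (\<lambda>C. f ` C) ` chamber_fan L U"
proof -
  have inner: "f a \<bullet> f b = a \<bullet> b" for a b
    using assms by (simp add: orthogonal_transformation_def)
  have reg: "regular_points (f ` L) (f ` U) = f ` regular_points L U"
    by (auto simp: regular_points_def inner)
  have "closed_chamber (f ` L) (f ` U) (f x) = f ` closed_chamber L U x" for x
    by (auto simp: closed_chamber_def inner)
  then show ?thesis by (simp add: chamber_fan_def reg image_image)
qed

text \<open>Rotations act transitively on pairs of a \<open>k\<close>-dimensional subspace and a normal direction in it up
  to sign, and the fan of one hyperplane is unaffected by rescaling its normal.\<close>
lemma rotation_invariant_chamber_fan_singleton: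
  fixes L L' :: "(real^'n) set"
  assumes \<phi>: "rotation_invariant \<phi>"
    and L: "subspace L" "subspace L'" "dim L = dim L'"
    and u: "u \<in> L" "u' \<in> L'" "u \<noteq> 0" "u' \<noteq> 0"
  shows "\<phi> (chamber_fan L {u}) = \<phi> (chamber_fan L' {u'})"
proof -
  define w where "w = (norm u / norm u') *\<^sub>R u'"
  have w: "w \<in> L'" "norm u = norm w" "w \<noteq> 0"
    using u L(2) by (auto simp: w_def subspace_mul)
  have scale: "chamber_fan L' {c *\<^sub>R u'} = chamber_fan L' {u'}" if "c \<noteq> 0" for c
  proof -
    have "(c * (u' \<bullet> x)) * (c * (u' \<bullet> y)) = c\<^sup>2 * ((u' \<bullet> x) * (u' \<bullet> y))" for x y
      by (simp add: power2_eq_square)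
    moreover have "0 < c\<^sup>2" using that by simp
    ultimately have "0 \<le> (c * (u' \<bullet> x)) * (c * (u' \<bullet> y)) \<longleftrightarrow> 0 \<le> (u' \<bullet> x) * (u' \<bullet> y)" for x y
      by (simp only: zero_le_mult_iff[of "c\<^sup>2"]) auto
    then show ?thesis
      using that by (simp add: chamber_fan_def regular_points_def closed_chamber_def)
  qed
  obtain Q where Q: "rotation_matrix Q" "(*v) Q ` L = L'" "Q *v u = w \<or> Q *v u = - w"
    using rotation_between_pointed_subspaces[OF L u(1) w] by blast
  have "orthogonal_transformation ((*v) Q)"
    using Q(1) by (simp add: rotation_matrix_def orthogonal_transformation_matrix)
  from chamber_fan_image[OF this, of L "{u}"]
  have "(\<lambda>C. (*v) Q ` C) ` chamber_fan L {u} = chamber_fan L' {Q *v u}" using Q(2) by simp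
  moreover obtain c where "Q *v u = c *\<^sub>R u'" "c \<noteq> 0"
    using Q(3) u(3,4) by (metis w_def scaleR_minus_left divide_eq_0_iff neg_equal_0_iff_equal norm_eq_zero)
  then have "chamber_fan L' {Q *v u} = chamber_fan L' {u'}" using scale by simp
  moreover have "\<phi> ((\<lambda>C. (*v) Q ` C) ` chamber_fan L {u}) = \<phi> (chamber_fan L {u})"
    using \<phi> Q(1) fan_chamber_fan[OF L(1), of "{u}"] by (simp add: rotation_invariant_def)
  ultimately show ?thesis by simp
qed

lemma rotation_invariant_singleton:
  fixes L L' :: "(real^'n) set"
  assumes \<phi>: "rotation_invariant \<phi>"
    and A: "singleton_arrangement k L A" "singleton_arrangement k L' A'"
  shows "\<phi> (arrangement_fan L A) = \<phi> (arrangement_fan L' A')"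
proof -
  have normal: "\<exists>u\<in>M. u \<noteq> 0 \<and> arrangement_fan M B = chamber_fan M {u}"
    if s: "singleton_arrangement k M B" for M :: "(real^'n) set" and B
  proof -
    obtain H where B: "B = {H}"
      using s by (auto simp: singleton_arrangement_def card_1_singleton_iff)
    then have M: "subspace M" "hyperplane_in M H"
      using s by (auto simp: singleton_arrangement_def arrangement_def)
    then obtain u where u: "u \<in> M" "u \<noteq> 0" "H = {x \<in> M. u \<bullet> x = 0}"
      using hyperplane_normal_exists by blast
    have "arrangement_fan M B = chamber_fan M {u}"
      by (rule arrangement_fan_eq_chamber_fan[OF M(1)]) (simp add: B u(3))
    then show ?thesis using u by blast
  qed
  have "subspace L" "subspace L'" "dim L = dim L'"
    using A by (auto simp: singleton_arrangement_def arrangement_def)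
  then show ?thesis
    using normal[OF A(1)] normal[OF A(2)] rotation_invariant_chamber_fan_singleton[OF \<phi>] by metis
qed

section \<open>Recovering the coefficients from the singletons\<close>

text \<open>The system is solved downwards from \<open>a d = 0\<close>; \<open>e j\<close> is the value at the index \<open>d - j\<close>.\<close>
lemma ex_alternating_recurrence:
  fixes c :: "nat \<Rightarrow> 'g::ab_group_add"
  shows "\<exists>a. a d = 0 \<and> (\<forall>k\<in>{1..d}. a k + a (k - 1) = c k)"
proof -
  define e where "e = rec_nat 0 (\<lambda>j x. c (d - j) - x)"
  have e: "e 0 = 0" "e (Suc j) = c (d - j) - e j" for j by (simp_all add: e_def)
  have "e (d - k) + e (d - (k - 1)) = c k" if "k \<in> {1..d}" for k
  proof -
    have "d - (k - 1) = Suc (d - k)" "d - (d - k) = k" using that by auto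
    then show ?thesis by (simp add: e)
  qed
  then show ?thesis using e(1) by (intro exI[of _ "\<lambda>i. e (d - i)"]) simp
qed

lemma alternating_recurrence_unique:
  fixes a b :: "nat \<Rightarrow> 'g::ab_group_add"
  assumes "a d = b d" "\<And>k. k \<in> {1..d} \<Longrightarrow> a k + a (k - 1) = b k + b (k - 1)" "i \<le> d"
  shows "a i = b i"
  using assms(3)
proof (induction i rule: inc_induct)
  case base
  show ?case by (rule assms(1))
next
  case (step i)
  then show ?case using assms(2)[of "Suc i"] by simp
qed

lemma nat_multiple_add: "nat_multiple (m + n) a = nat_multiple m a + nat_multiple n a"
  by (induction n) (simp_all add: nat_multiple_def algebra_simps)

lemma nat_multiple_0: "nat_multiple 0 a = 0" and nat_multiple_1: "nat_multiple (Suc 0) a = a"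
  by (simp_all add: nat_multiple_def)

text \<open>The additive map from polynomials to the group with \<open>t\<^sup>i \<mapsto> a i\<close> for \<open>i < d\<close>, which kills all
  powers from \<open>t\<^sup>d\<close> on.\<close>
definition coeff_pairing :: "nat \<Rightarrow> (nat \<Rightarrow> 'g::ab_group_add) \<Rightarrow> nat poly \<Rightarrow> 'g" where
  "coeff_pairing d a p = (\<Sum>i<d. nat_multiple (coeff p i) (a i))"

lemma coeff_pairing_add:
  "coeff_pairing d a (p + q) = coeff_pairing d a p + coeff_pairing d a q"
  by (simp add: coeff_pairing_def nat_multiple_add sum.distrib)

lemma coeff_pairing_monom:
  "coeff_pairing d a (monom 1 k) = (if k < d then a k else 0)"
proof -
  have "coeff_pairing d a (monom 1 k) = (\<Sum>i<d. if i = k then a i else 0)"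
    unfolding coeff_pairing_def
    by (intro sum.cong) (auto simp: nat_multiple_0 nat_multiple_1)
  then show ?thesis by (simp add: sum.delta)
qed

text \<open>The convention \<open>a d = 0\<close> makes the top case \<open>k = d\<close>, where the leading power is discarded,
  uniform with the others.\<close>
lemma coeff_pairing_singleton:
  assumes "singleton_arrangement k L A" "k \<in> {1..d}" "a d = 0"
  shows "coeff_pairing d a (ucharpoly L A) = a k + a (k - 1)"
  using assms(2,3)
  by (cases "k = d") (simp_all add: ucharpoly_singleton[OF assms(1)] coeff_pairing_add
      coeff_pairing_monom[unfolded One_nat_def] less_imp_diff_less)

lemma singleton_arrangement_dim:
  fixes L :: "'a::euclidean_space set"
  assumes "singleton_arrangement k L A"
  shows "k \<in> {1..DIM('a)}"
proof -
  obtain H where "hyperplane_in L H" "dim L = k"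
    using assms by (auto simp: singleton_arrangement_def arrangement_def)
  then show ?thesis using dim_subset_UNIV[of L] by (auto simp: hyperplane_in_def)
qed

section \<open>The Whitney number formula\<close>

theorem theorem2p3:
  fixes \<phi> :: "(real^'n) set set \<Rightarrow> 'g::ab_group_add"
  assumes "invariant_fan_valuation \<phi>"
  shows "\<exists>a :: nat \<Rightarrow> 'g.
    (\<forall>L A. arrangement L A \<longrightarrow>
       \<phi> (arrangement_fan L A) = (\<Sum>i<CARD('n). nat_multiple (whitney_number i L A) (a i))) \<and>
    (\<forall>(\<psi> :: (real^'n) set set \<Rightarrow> 'g) (b :: nat \<Rightarrow> 'g)
       (L :: nat \<Rightarrow> (real^'n) set) (A :: nat \<Rightarrow> (real^'n) set set).
       invariant_fan_valuation \<psi> \<longrightarrow>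
       (\<forall>M B. arrangement M B \<longrightarrow>
          \<psi> (arrangement_fan M B) = (\<Sum>i<CARD('n). nat_multiple (whitney_number i M B) (b i))) \<longrightarrow>
       (\<forall>k\<in>{1..CARD('n)}. singleton_arrangement k (L k) (A k) \<and>
          \<psi> (arrangement_fan (L k) (A k)) = \<phi> (arrangement_fan (L k) (A k))) \<longrightarrow>
       (\<forall>i<CARD('n). b i = a i))"
proof -
  let ?d = "CARD('n)"
  have val: "fan_valuation \<phi>" and rot: "rotation_invariant \<phi>"
    using assms by (auto simp: invariant_fan_valuation_def)
  have "\<exists>c. \<forall>L A. singleton_arrangement k L A \<longrightarrow> \<phi> (arrangement_fan L A) = c" for k
    using rotation_invariant_singleton[OF rot] by meson
  then obtain c where
    c: "\<phi> (arrangement_fan L A) = c k" if "singleton_arrangement k L A" for k L A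
    by metis
  obtain a where a0: "a ?d = 0" and a: "\<And>k. k \<in> {1..?d} \<Longrightarrow> a k + a (k - 1) = c k"
    using ex_alternating_recurrence[of ?d c] by blast
  have main: "\<phi> (arrangement_fan L A) = coeff_pairing ?d a p" if "is_ucharpoly L A p" for L A p
    using that
  proof induction
    case (singleton k L A)
    have "k \<in> {1..?d}" using singleton_arrangement_dim[OF singleton] by simp
    then show ?case
      using coeff_pairing_singleton[of k L A ?d a, OF singleton _ a0] a c[OF singleton]
      by (metis ucharpoly_singleton[OF singleton])
  next
    case (deletion_restriction L A H p q)
    then show ?case
      using arrangement_fan_deletion_restriction[OF val, of L A H] by (simp add: coeff_pairing_add)
  qed
  have rep: "\<phi> (arrangement_fan L A) = (\<Sum>i<?d. nat_multiple (whitney_number i L A) (a i))"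
    if "arrangement L A" for L A
    using main[OF is_ucharpoly_ucharpoly[OF that]]
    by (simp add: coeff_pairing_def whitney_number_def)
  have uniq: "b i = a i"
    if rep': "\<forall>M B. arrangement M B \<longrightarrow>
          \<psi> (arrangement_fan M B) = (\<Sum>i<?d. nat_multiple (whitney_number i M B) (b i))"
      and sing: "\<forall>k\<in>{1..?d}. singleton_arrangement k (L k) (A k) \<and>
          \<psi> (arrangement_fan (L k) (A k)) = \<phi> (arrangement_fan (L k) (A k))"
      and i: "i < ?d"
    for \<psi> :: "(real^'n) set set \<Rightarrow> 'g" and b :: "nat \<Rightarrow> 'g"
      and L :: "nat \<Rightarrow> (real^'n) set" and A :: "nat \<Rightarrow> (real^'n) set set" and i
  proof -
    \<comment> \<open>The boundary value that \<open>a\<close> has as well, so that both solve the same recurrence.\<close>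
    define b' where "b' = b(?d := 0)"
    have step: "a k + a (k - 1) = b' k + b' (k - 1)" if k: "k \<in> {1..?d}" for k
    proof -
      have s: "singleton_arrangement k (L k) (A k)" "arrangement (L k) (A k)"
        using sing k by (auto simp: singleton_arrangement_def)
      have "a k + a (k - 1) = \<phi> (arrangement_fan (L k) (A k))" using a[OF k] c[OF s(1)] by simp
      also have "\<dots> = \<psi> (arrangement_fan (L k) (A k))" using sing k by simp
      also have "\<dots> = coeff_pairing ?d b' (ucharpoly (L k) (A k))"
        using rep' s(2) by (simp add: coeff_pairing_def whitney_number_def b'_def)
      also have "\<dots> = b' k + b' (k - 1)"
        by (rule coeff_pairing_singleton[OF s(1) k]) (simp add: b'_def)
      finally show ?thesis .
    qed
    have "a ?d = b' ?d" using a0 by (simp add: b'_def)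
    from alternating_recurrence_unique[of a ?d b', OF this step] have "a i = b' i"
      using i by simp
    then show ?thesis using i by (simp add: b'_def)
  qed
  show ?thesis
  proof (intro exI[of _ a] conjI allI impI, rule rep)
    fix \<psi> :: "(real^'n) set set \<Rightarrow> 'g" and b L A i
    assume "\<forall>M B. arrangement M B \<longrightarrow>
          \<psi> (arrangement_fan M B) = (\<Sum>i<?d. nat_multiple (whitney_number i M B) (b i))"
      and "\<forall>k\<in>{1..?d}. singleton_arrangement k (L k) (A k) \<and>
          \<psi> (arrangement_fan (L k) (A k)) = \<phi> (arrangement_fan (L k) (A k))"
      and "i < ?d"
    then show "b i = a i" by (rule uniq[of \<psi> b L A i])
  qed
qed

end
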